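(* A finite simple graph $G$ is threshold if and only if $G$ is the co-occurrence graph of some $1$-Sperner hypergraph.
   Context: A hypergraph $\mathcal{H}=(V,E)$ consists of a finite vertex set $V$ and a set $E$ of subsets of $V$ (hyperedges). $\mathcal{H}$ is $1$-Sperner if every two distinct hyperedges $e,f$ satisfy $\min\{|e\setminus f|,|f\setminus e|\}=1$. The co-occurrence graph of $\mathcal{H}$ is the graph with vertex set $V$ in which two distinct vertices are adjacent if and only if some hyperedge of $\mathcal{H}$ contains both. A graph $G=(V,E)$ is threshold if there exist $w:V\to\mathbb{Z}_{\ge0}$ and $t\in\mathbb{Z}_{\ge0}$ such that for every $X\subseteq V$, $\sum_{x\in X}w(x)\le t$ if and only if $X$ is an independent set of $G$. *)

theory Defs
  imports "HOL-Library.Ramsey"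
begin

text \<open>
  Graphs and hypergraphs are pairs of a vertex set and a set of (hyper)edges. Edges of a simple
  graph are two-element subsets of the vertex set, and \<open>[V]\<^bsup>2\<^esup>\<close> and \<open>indep\<close>
  are the notions from Ramsey theory in the library. Hyperedges may be arbitrary subsets,
  in particular empty.
\<close>

fun simple_graph :: "'a set \<times> 'a set set \<Rightarrow> bool" where
  "simple_graph (V, E) \<longleftrightarrow> finite V \<and> E \<subseteq> [V]\<^bsup>2\<^esup>"

fun hypergraph :: "'a set \<times> 'a set set \<Rightarrow> bool" where
  "hypergraph (V, E) \<longleftrightarrow> finite V \<and> E \<subseteq> Pow V"

fun one_Sperner :: "'a set \<times> 'a set set \<Rightarrow> bool" where
  "one_Sperner (V, E) \<longleftrightarrow>
     (\<forall>e\<in>E. \<forall>f\<in>E. e \<noteq> f \<longrightarrow> min (card (e - f)) (card (f - e)) = 1)"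

fun co_occurrence_graph :: "'a set \<times> 'a set set \<Rightarrow> 'a set \<times> 'a set set" where
  "co_occurrence_graph (V, E) =
     (V, {{u, v} |u v. u \<in> V \<and> v \<in> V \<and> u \<noteq> v \<and> (\<exists>e\<in>E. u \<in> e \<and> v \<in> e)})"

fun threshold_graph :: "'a set \<times> 'a set set \<Rightarrow> bool" where
  "threshold_graph (V, E) \<longleftrightarrow>
     (\<exists>(w :: 'a \<Rightarrow> nat) (t :: nat). \<forall>X\<subseteq>V. (\<Sum>x\<in>X. w x) \<le> t \<longleftrightarrow> indep X E)"

end

theory Submission
  imports Defs
begin

text \<open>
  If \<open>G\<close> is threshold, distinct vertices are adjacent iff their weights sum to more than \<open>t\<close>,
  and the hypergraph of maximal cliques is 1-Sperner: the side of the symmetric difference of two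
  maximal cliques that contains a vertex of minimum weight has no second vertex.

  Conversely, if \<open>ab\<close>, \<open>cd\<close> are edges and \<open>ac\<close>, \<open>bd\<close> are non-edges of a co-occurrence graph,
  then hyperedges \<open>e\<close>, \<open>f\<close> containing \<open>ab\<close> and \<open>cd\<close> have both differences of size at least two.
  A graph without such alternating 4-cycles has an isolated or a dominating vertex, and
  threshold weights are built by deleting these one at a time.
\<close>

section \<open>Maximal cliques of a graph and the hypergraph they form\<close>

definition max_clique :: "'a set \<Rightarrow> 'a set set \<Rightarrow> 'a set \<Rightarrow> bool" where
  "max_clique V E C \<longleftrightarrow> C \<subseteq> V \<and> clique C E \<and> (\<forall>D. D \<subseteq> V \<longrightarrow> clique D E \<longrightarrow> C \<subseteq> D \<longrightarrow> D = C)"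

lemma clique_extends_to_max_clique:
  assumes "finite V" "C \<subseteq> V" "clique C E"
  obtains D where "max_clique V E D" "C \<subseteq> D"
proof -
  let ?A = "{D. D \<subseteq> V \<and> clique D E}"
  have "finite ?A"
    using assms(1) by simp
  moreover have "C \<in> ?A"
    using assms by simp
  ultimately have "\<exists>D\<in>?A. C \<subseteq> D \<and> (\<forall>B\<in>?A. D \<subseteq> B \<longrightarrow> D = B)"
    by (rule finite_has_maximal2)
  then obtain D where "D \<in> ?A" "C \<subseteq> D" "\<forall>B\<in>?A. D \<subseteq> B \<longrightarrow> D = B"
    by blast
  then have "max_clique V E D" "C \<subseteq> D"
    unfolding max_clique_def by auto
  then show thesis
    by (rule that)
qed

text \<open>Otherwise \<open>insert x C\<close> would be a strictly larger clique inside
  \<open>V\<close>.\<close>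

lemma max_clique_nonneighbour:
  assumes "max_clique V E C" "x \<in> V" "x \<notin> C"
  obtains y where "y \<in> C" "{x, y} \<notin> E"
proof -
  have "\<not> clique (insert x C) E"
    using assms unfolding max_clique_def by blast
  moreover have "clique C E"
    using assms(1) unfolding max_clique_def by blast
  ultimately obtain y where "y \<in> C" "{x, y} \<notin> E"
    unfolding clique_def by (auto simp: insert_commute)
  then show thesis
    using that by blast
qed

text \<open>This is the weight criterion for the set \<open>{u, v}\<close>, the form in which the
  argument on maximal cliques uses the weights.\<close>

lemma threshold_adjacency:
  fixes w :: "'a \<Rightarrow> nat"
  assumes "\<forall>X\<subseteq>V. (\<Sum>x\<in>X. w x) \<le> t \<longleftrightarrow> indep X E" "u \<in> V" "v \<in> V" "u \<noteq> v"
  shows "{u, v} \<in> E \<longleftrightarrow> t < w u + w v"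
proof -
  have "w u + w v \<le> t \<longleftrightarrow> indep {u, v} E"
    using assms(1)[rule_format, of "{u, v}"] assms(2-4) by simp
  then show ?thesis
    using assms(4) unfolding indep_def by (auto simp: insert_commute)
qed

text \<open>A second vertex \<open>b\<close> of \<open>e - f\<close> has a non-neighbour
  \<open>y\<close> in \<open>f\<close>, as \<open>f\<close> is maximal. Since \<open>e\<close> is a
  clique, \<open>y\<close> lies in \<open>f - e\<close>, so \<open>w a \<le> w y\<close>. The edge
  \<open>ab\<close> then gives \<open>t < w a + w b \<le> w b + w y\<close>, making
  \<open>by\<close> an edge after all.\<close>

lemma max_cliques_difference_singleton:
  fixes w :: "'a \<Rightarrow> nat"
  assumes adj: "\<And>u v. u \<in> V \<Longrightarrow> v \<in> V \<Longrightarrow> u \<noteq> v \<Longrightarrow> {u, v} \<in> E \<longleftrightarrow> t < w u + w v"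
    and e: "max_clique V E e" and f: "max_clique V E f"
    and a: "a \<in> e - f" and le: "\<And>y. y \<in> f - e \<Longrightarrow> w a \<le> w y"
  shows "e - f = {a}"
proof -
  have sub: "e \<subseteq> V" "f \<subseteq> V"
    and cl: "\<And>x y. x \<in> e \<Longrightarrow> y \<in> e \<Longrightarrow> x \<noteq> y \<Longrightarrow> {x, y} \<in> E"
    using e f unfolding max_clique_def clique_def by auto
  have False if b: "b \<in> e - f" "b \<noteq> a" for b
  proof -
    have bV: "b \<in> V" and aV: "a \<in> V" and bf: "b \<notin> f"
      using a b sub by auto
    obtain y where y: "y \<in> f" "{b, y} \<notin> E"
      using max_clique_nonneighbour[OF f bV bf] .
    have "y \<noteq> b"
      using y b by blast
    then have "y \<notin> e"
      using y b cl[of b y] by auto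
    have "{a, b} \<in> E"
      using a b cl[of a b] by auto
    then have "t < w a + w b"
      using adj[OF aV bV] b(2) by simp
    also have "\<dots> \<le> w b + w y"
      using le[of y] y \<open>y \<notin> e\<close> by simp
    finally have "{b, y} \<in> E"
      using adj[OF bV, of y] y sub \<open>y \<noteq> b\<close> by auto
    then show False
      using y by simp
  qed
  then show ?thesis
    using a by blast
qed

lemma threshold_max_cliques_one_Sperner:
  fixes w :: "'a \<Rightarrow> nat"
  assumes fin: "finite V"
    and adj: "\<And>u v. u \<in> V \<Longrightarrow> v \<in> V \<Longrightarrow> u \<noteq> v \<Longrightarrow> {u, v} \<in> E \<longleftrightarrow> t < w u + w v"
  shows "one_Sperner (V, {C. max_clique V E C})"
proof -
  have "min (card (e - f)) (card (f - e)) = 1"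
    if e: "max_clique V E e" and f: "max_clique V E f" and ne: "e \<noteq> f" for e f
  proof -
    have fin': "finite e" "finite f"
      using e f fin unfolding max_clique_def by (auto intro: finite_subset)
    \<comment> \<open>Neither of two distinct maximal cliques contains the other, so the minimum is
      at least 1 and one difference of size 1 suffices.\<close>
    have diff: "e - f \<noteq> {}" "f - e \<noteq> {}"
      using e f ne unfolding max_clique_def by auto
    then have pos: "0 < card (e - f)" "0 < card (f - e)"
      using fin' by (simp_all add: card_gt_0_iff)
    obtain a where a: "a \<in> (e - f) \<union> (f - e)"
      and le: "\<And>y. y \<in> (e - f) \<union> (f - e) \<Longrightarrow> w a \<le> w y"
      using ex_is_arg_min_if_finite[of "(e - f) \<union> (f - e)" w] fin' diff
      by (auto simp: is_arg_min_linorder)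
    from a have "e - f = {a} \<or> f - e = {a}"
    proof
      assume "a \<in> e - f"
      then show ?thesis
        using max_cliques_difference_singleton[OF adj e f] le by blast
    next
      assume "a \<in> f - e"
      then show ?thesis
        using max_cliques_difference_singleton[OF adj f e] le by blast
    qed
    then have "card (e - f) = 1 \<or> card (f - e) = 1"
      by fastforce
    then show ?thesis
      using pos by auto
  qed
  then show ?thesis
    by simp
qed

text \<open>Every edge is itself a two-vertex clique and so lies in a maximal one; conversely, two
  vertices of a common clique are adjacent.\<close>

lemma co_occurrence_max_cliques:
  assumes "simple_graph (V, E)"
  shows "co_occurrence_graph (V, {C. max_clique V E C}) = (V, E)"
proof -
  have fin: "finite V" and E: "E \<subseteq> [V]\<^bsup>2\<^esup>"
    using assms by auto
  have "{u, v} \<in> E" if "max_clique V E C" "u \<in> C" "v \<in> C" "u \<noteq> v" for u v C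
    using that unfolding max_clique_def clique_def by blast
  moreover have "\<exists>u v. p = {u, v} \<and> u \<in> V \<and> v \<in> V \<and> u \<noteq> v \<and> (\<exists>C. max_clique V E C \<and> u \<in> C \<and> v \<in> C)"
    if p: "p \<in> E" for p
  proof -
    from p E have "p \<subseteq> V" "card p = 2"
      by (auto simp: nsets_def)
    then obtain u v where uv: "p = {u, v}" "u \<noteq> v"
      by (auto simp: card_2_iff)
    have "clique p E"
      using p uv unfolding clique_def by (auto simp: insert_commute)
    obtain D where "max_clique V E D" "p \<subseteq> D"
      using clique_extends_to_max_clique[OF fin \<open>p \<subseteq> V\<close> \<open>clique p E\<close>] .
    then show ?thesis
      using uv \<open>p \<subseteq> V\<close> by blast
  qed
  ultimately show ?thesis
    by auto
qed

section \<open>Graphs without alternating 4-cycles\<close>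

text \<open>Depending on the pairs \<open>ad\<close> and \<open>bc\<close>, a violation induces
  \<open>2K_2\<close>, \<open>P_4\<close> or \<open>C_4\<close>. If \<open>a = d\<close> or
  \<open>b = c\<close>, the conclusion is immediate, as one of its pairs is then
  \<open>{a, b}\<close>.\<close>

definition alternating_4_cycle_free :: "'a set \<Rightarrow> 'a set set \<Rightarrow> bool" where
  "alternating_4_cycle_free V E \<longleftrightarrow>
     (\<forall>a\<in>V. \<forall>b\<in>V. \<forall>c\<in>V. \<forall>d\<in>V. a \<noteq> b \<longrightarrow> c \<noteq> d \<longrightarrow> a \<noteq> c \<longrightarrow> b \<noteq> d \<longrightarrow>
        {a, b} \<in> E \<longrightarrow> {c, d} \<in> E \<longrightarrow> {a, c} \<in> E \<or> {b, d} \<in> E)"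

lemma co_occurrence_alternating_4_cycle_free:
  assumes "hypergraph (V, F)" "one_Sperner (V, F)" "co_occurrence_graph (V, F) = (V, E)"
  shows "alternating_4_cycle_free V E"
  unfolding alternating_4_cycle_free_def
proof (intro ballI impI)
  fix a b c d
  assume V: "a \<in> V" "b \<in> V" "c \<in> V" "d \<in> V"
    and ne: "a \<noteq> b" "c \<noteq> d" "a \<noteq> c" "b \<noteq> d" and E: "{a, b} \<in> E" "{c, d} \<in> E"
  have adj: "{u, v} \<in> E \<longleftrightarrow> (\<exists>e\<in>F. u \<in> e \<and> v \<in> e)" if "u \<in> V" "v \<in> V" "u \<noteq> v" for u v
  proof -
    have "E = {{u, v} |u v. u \<in> V \<and> v \<in> V \<and> u \<noteq> v \<and> (\<exists>e\<in>F. u \<in> e \<and> v \<in> e)}"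
      using assms(3) by simp
    then show ?thesis
      using that by (simp add: doubleton_eq_iff) blast
  qed
  obtain e where e: "e \<in> F" "a \<in> e" "b \<in> e"
    using adj[OF V(1,2) ne(1)] E(1) by blast
  obtain f where f: "f \<in> F" "c \<in> f" "d \<in> f"
    using adj[OF V(3,4) ne(2)] E(2) by blast
  show "{a, c} \<in> E \<or> {b, d} \<in> E"
  proof (rule ccontr)
    assume "\<not> ?thesis"
    \<comment> \<open>No hyperedge contains both \<open>a\<close> and \<open>c\<close>, or both
      \<open>b\<close> and \<open>d\<close>; each of the four vertices is thereby kept out of the
      opposite hyperedge.\<close>
    then have sub: "{a, b} \<subseteq> e - f" "{c, d} \<subseteq> f - e"
      using adj[OF V(1,3) ne(3)] adj[OF V(2,4) ne(4)] e f by blast+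
    have "finite e" "finite f"
      using assms(1) e f by (auto intro: finite_subset)
    then have "card {a, b} \<le> card (e - f)" "card {c, d} \<le> card (f - e)"
      using sub by (simp_all only: card_mono finite_Diff)
    then have "2 \<le> card (e - f)" "2 \<le> card (f - e)"
      using ne by simp_all
    moreover have "min (card (e - f)) (card (f - e)) = 1"
      using assms(2) e f sub unfolding one_Sperner.simps by blast
    ultimately show False
      by auto
  qed
qed

section \<open>Elimination of isolated and dominating vertices\<close>

text \<open>Take \<open>v\<close> of maximum degree. If \<open>v\<close> is not dominating, any
  non-neighbour \<open>u\<close> of \<open>v\<close> is isolated: a neighbour of \<open>u\<close>
  would exceed \<open>v\<close> in degree.\<close>

lemma isolated_or_dominating:
  assumes fin: "finite V" and "V \<noteq> {}" and free: "alternating_4_cycle_free V E"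
  obtains (isolated) v where "v \<in> V" "\<And>x. x \<in> V \<Longrightarrow> x \<noteq> v \<Longrightarrow> {v, x} \<notin> E"
  | (dominating) v where "v \<in> V" "\<And>x. x \<in> V \<Longrightarrow> x \<noteq> v \<Longrightarrow> {v, x} \<in> E"
proof -
  define N where "N v = {x \<in> V. x \<noteq> v \<and> {v, x} \<in> E}" for v
  have finN: "finite (N v)" for v
    using fin by (simp add: N_def)
  obtain v where v: "v \<in> V" and max: "\<And>x. x \<in> V \<Longrightarrow> card (N x) \<le> card (N v)"
    using Max_in[of "(\<lambda>v. card (N v)) ` V"] Max_ge[of "(\<lambda>v. card (N v)) ` V"] fin \<open>V \<noteq> {}\<close>
    by fastforce
  show thesis
  proof (cases "\<forall>x\<in>V. x \<noteq> v \<longrightarrow> {v, x} \<in> E")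
    case True
    then show thesis
      using dominating v by blast
  next
    case False
    then obtain u where u: "u \<in> V" "u \<noteq> v" "{v, u} \<notin> E"
      by blast
    have "{u, x} \<notin> E" if x: "x \<in> V" "x \<noteq> u" for x
    proof
      assume ux: "{u, x} \<in> E"
      \<comment> \<open>Then \<open>x\<close> has larger degree than \<open>v\<close>.\<close>
      have xv: "x \<noteq> v"
        using ux u by (auto simp: insert_commute)
      have sub: "N v - {x} \<subseteq> N x"
      proof
        fix y
        assume "y \<in> N v - {x}"
        then have y: "y \<in> V" "y \<noteq> v" "y \<noteq> x" "{v, y} \<in> E"
          by (auto simp: N_def)
        \<comment> \<open>The edges \<open>vy\<close> and \<open>ux\<close> together with the
          non-edge \<open>vu\<close> force the edge \<open>yx\<close>.\<close>
        have "{v, u} \<in> E \<or> {y, x} \<in> E"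
          using free[unfolded alternating_4_cycle_free_def, rule_format, of v y u x] v u x y ux by auto
        then show "y \<in> N x"
          using u y by (auto simp: N_def insert_commute)
      qed
      have ue: "u \<in> N x" "u \<notin> N v"
        using u x ux by (auto simp: N_def insert_commute)
      have "card (N v) < card (N x)"
      proof (cases "x \<in> N v")
        case True
        then have vx: "v \<in> N x"
          using v xv by (auto simp: N_def insert_commute)
        have "v \<notin> N v"
          by (simp add: N_def)
        \<comment> \<open>The neighbour \<open>x\<close> of \<open>v\<close> is lost, since
          \<open>x\<close> is not in \<open>N x\<close>; \<open>v\<close> makes up for it and
          \<open>u\<close> makes the inequality strict.\<close>
        have "insert u (insert v (N v - {x})) \<subseteq> N x"
          using sub ue vx by blast
        then have "card (insert u (insert v (N v - {x}))) \<le> card (N x)"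
          using finN by (rule card_mono[rotated])
        moreover have "card (insert u (insert v (N v - {x}))) = Suc (Suc (card (N v - {x})))"
          using finN ue u \<open>v \<notin> N v\<close> by simp
        moreover have "Suc (card (N v - {x})) = card (N v)"
          using finN True by (rule card_Suc_Diff1)
        ultimately show ?thesis
          by simp
      next
        case False
        then have "N v \<subset> N x"
          using sub ue by blast
        then show ?thesis
          using finN by (rule psubset_card_mono[rotated])
      qed
      then show False
        using max[OF x(1)] by simp
    qed
    then show thesis
      using isolated u by blast
  qed
qed

text \<open>Positivity lets an added dominating vertex get weight \<open>t\<close>: it excludes every other vertex.\<close>

lemma alternating_4_cycle_free_weights:
  assumes "finite V" "alternating_4_cycle_free V E"
  shows "\<exists>(w :: 'a \<Rightarrow> nat) t. 0 < t \<and> (\<forall>x\<in>V. 0 < w x) \<and> (\<forall>X\<subseteq>V. (\<Sum>x\<in>X. w x) \<le> t \<longleftrightarrow> indep X E)"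
  using assms
proof (induction V rule: finite_psubset_induct)
  case (psubset V)
  show ?case
  proof (cases "V = {}")
    case True
    then show ?thesis
      by (auto simp: indep_def)
  next
    case False
    \<comment> \<open>Only the vertex set shrinks. \<open>E\<close> can stay, because independence
      of subsets of \<open>V - {v}\<close> and the cycle condition there look only at pairs inside
      \<open>V - {v}\<close>.\<close>
    have IH: "\<exists>(w :: 'a \<Rightarrow> nat) t. 0 < t \<and> (\<forall>x\<in>V - {v}. 0 < w x) \<and>
        (\<forall>X\<subseteq>V - {v}. (\<Sum>x\<in>X. w x) \<le> t \<longleftrightarrow> indep X E)" if "v \<in> V" for v
    proof (rule psubset.IH)
      show "V - {v} \<subset> V"
        using that by blast
      show "alternating_4_cycle_free (V - {v}) E"
        using psubset.prems unfolding alternating_4_cycle_free_def by blast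
    qed
    from psubset.hyps False psubset.prems show ?thesis
    proof (cases rule: isolated_or_dominating)
      case (isolated v)
      obtain w :: "'a \<Rightarrow> nat" and t where pos: "\<forall>x\<in>V - {v}. 0 < w x"
        and w: "\<forall>X\<subseteq>V - {v}. (\<Sum>x\<in>X. w x) \<le> t \<longleftrightarrow> indep X E"
        using IH isolated(1) by blast
      \<comment> \<open>Doubling makes room for a vertex that never matters: with bound
        \<open>2 * t + 1\<close>, both \<open>2 * s\<close> and \<open>2 * s + 1\<close> are within
        the bound exactly when \<open>s \<le> t\<close>.\<close>
      define w' where "w' x = (if x = v then 1 else 2 * w x)" for x
      have "(\<Sum>x\<in>X. w' x) \<le> 2 * t + 1 \<longleftrightarrow> indep X E" if X: "X \<subseteq> V" for X
      proof -
        have finX: "finite X"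
          using X psubset.hyps by (rule finite_subset)
        have rest: "(\<Sum>x\<in>X - {v}. w' x) = 2 * (\<Sum>x\<in>X - {v}. w x)"
          unfolding sum_distrib_left by (rule sum.cong) (auto simp: w'_def)
        have "(\<Sum>x\<in>X. w' x) = (if v \<in> X then 1 else 0) + 2 * (\<Sum>x\<in>X - {v}. w x)"
          using sum.remove[OF finX, of v w'] rest by (cases "v \<in> X") (simp_all add: w'_def[of v])
        then have "(\<Sum>x\<in>X. w' x) \<le> 2 * t + 1 \<longleftrightarrow> (\<Sum>x\<in>X - {v}. w x) \<le> t"
          by auto
        also have "\<dots> \<longleftrightarrow> indep (X - {v}) E"
          using w X by blast
        also have "\<dots> \<longleftrightarrow> indep X E"
        proof
          assume ind: "indep (X - {v}) E"
          have "{x, y} \<notin> E" if "x \<in> X" "y \<in> X" "x \<noteq> y" for x y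
          proof (cases "x = v \<or> y = v")
            case True
            then show ?thesis
              using isolated(2)[of x] isolated(2)[of y] X that by (auto simp: insert_commute)
          next
            case False
            then show ?thesis
              using ind that by (simp add: indep_def)
          qed
          then show "indep X E"
            by (simp add: indep_def)
        qed (simp add: indep_def)
        finally show ?thesis .
      qed
      moreover have "\<forall>x\<in>V. 0 < w' x"
        using pos by (simp add: w'_def)
      moreover have "0 < 2 * t + 1"
        by simp
      ultimately show ?thesis
        by (intro exI[of _ w'] exI[of _ "2 * t + 1"]) simp
    next
      case (dominating v)
      obtain w :: "'a \<Rightarrow> nat" and t where t: "0 < t" and pos: "\<forall>x\<in>V - {v}. 0 < w x"
        and w: "\<forall>X\<subseteq>V - {v}. (\<Sum>x\<in>X. w x) \<le> t \<longleftrightarrow> indep X E"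
        using IH dominating(1) by blast
      \<comment> \<open>The vertex \<open>v\<close> alone uses up the whole bound, so a set
        containing \<open>v\<close> is light only if the rest weighs 0, which by \<open>pos\<close>
        means that the rest is empty.\<close>
      have "(\<Sum>x\<in>X. (w(v := t)) x) \<le> t \<longleftrightarrow> indep X E" if X: "X \<subseteq> V" for X
      proof (cases "v \<in> X")
        case False
        then have "(\<Sum>x\<in>X. (w(v := t)) x) = (\<Sum>x\<in>X. w x)"
          by (intro sum.cong) auto
        then show ?thesis
          using w[rule_format, of X] X False by (simp add: subset_Diff_insert)
      next
        case True
        have finX: "finite X"
          using X psubset.hyps by (rule finite_subset)
        have rest: "(\<Sum>x\<in>X - {v}. (w(v := t)) x) = (\<Sum>x\<in>X - {v}. w x)"
          by (rule sum.cong) auto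
        have "(\<Sum>x\<in>X. (w(v := t)) x) = t + (\<Sum>x\<in>X - {v}. w x)"
          using sum.remove[OF finX True, of "w(v := t)"] rest by simp
        then have "(\<Sum>x\<in>X. (w(v := t)) x) \<le> t \<longleftrightarrow> (\<Sum>x\<in>X - {v}. w x) = 0"
          by simp
        also have "\<dots> \<longleftrightarrow> (\<forall>x\<in>X - {v}. w x = 0)"
          using finX by simp
        also have "\<dots> \<longleftrightarrow> X - {v} = {}"
        proof -
          have "w x \<noteq> 0" if "x \<in> X - {v}" for x
            using pos X that by auto
          then show ?thesis
            by blast
        qed
        also have "\<dots> \<longleftrightarrow> indep X E"
        proof
          assume "X - {v} = {}"
          then have "X = {v}"
            using True by blast
          then show "indep X E"
            by (simp add: indep_def)
        next
          assume "indep X E"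
          then have "{v, x} \<notin> E" if "x \<in> X" "x \<noteq> v" for x
            using True that unfolding indep_def by simp
          then show "X - {v} = {}"
            using dominating(2) X by blast
        qed
        finally show ?thesis .
      qed
      \<comment> \<open>The new weight of \<open>v\<close> is \<open>t\<close>, which is why
        \<open>0 < t\<close> is carried through the induction.\<close>
      moreover have "\<forall>x\<in>V. 0 < (w(v := t)) x"
        using pos t by simp
      ultimately show ?thesis
        using t by (intro exI[of _ "w(v := t)"] exI[of _ t]) simp
    qed
  qed
qed

theorem theorem3p5:
  fixes G :: "'a set \<times> 'a set set"
  assumes "simple_graph G"
  shows "threshold_graph G \<longleftrightarrow>
    (\<exists>H :: 'a set \<times> 'a set set. hypergraph H \<and> one_Sperner H \<and> G = co_occurrence_graph H)"
proof -
  obtain V E where G: "G = (V, E)"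
    by fastforce
  have sg: "simple_graph (V, E)" and fin: "finite V"
    using assms G by auto
  show ?thesis
  proof
    assume "threshold_graph G"
    then obtain w :: "'a \<Rightarrow> nat" and t where "\<forall>X\<subseteq>V. (\<Sum>x\<in>X. w x) \<le> t \<longleftrightarrow> indep X E"
      using G by auto
    from threshold_max_cliques_one_Sperner[OF fin threshold_adjacency[OF this]]
    have "one_Sperner (V, {C. max_clique V E C})" .
    moreover have "hypergraph (V, {C. max_clique V E C})"
      using fin by (auto simp: max_clique_def)
    moreover have "G = co_occurrence_graph (V, {C. max_clique V E C})"
      using co_occurrence_max_cliques[OF sg] G by simp
    ultimately show "\<exists>H. hypergraph H \<and> one_Sperner H \<and> G = co_occurrence_graph H"
      by blast
  next
    assume "\<exists>H. hypergraph H \<and> one_Sperner H \<and> G = co_occurrence_graph H"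
    then obtain W F where H: "hypergraph (W, F)" "one_Sperner (W, F)" "G = co_occurrence_graph (W, F)"
      by fastforce
    \<comment> \<open>Forming the co-occurrence graph keeps the vertex set.\<close>
    then have "W = V"
      using G by simp
    then have "alternating_4_cycle_free V E"
      using co_occurrence_alternating_4_cycle_free H G by metis
    then show "threshold_graph G"
      using alternating_4_cycle_free_weights[OF fin] unfolding G threshold_graph.simps by blast
  qed
qed

end
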